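(* Let $A=\operatorname{diag}(\lambda_1,\dots,\lambda_n)$ with pairwise distinct $\lambda_i\in\mathbb C$, and let $C=C(p^* )$ be a critical torus with active support $S$. The linearized flow in the active variables, i.e. the linearization $L_S$ at $p^*$ of the residual flow on the simplex under perturbations $p_i=p_i^*+a_i$ ($i\in S$), $a\in V_S$, with all inactive coordinates kept zero, is \[ (L_Sa)_i=8p_i^*\operatorname{Re}\left(q_i\overline{\delta z}\right),\qquad i\in S. \] Equivalently, if one identifies the complex plane with $\mathbb R^2$ and writes $q_i\cdot y=\operatorname{Re}(q_i\overline y)$, then \[ (L_Sa)_i=8p_i^*(q_i\cdot\delta z). \]
   Context: The residual flow on the simplex $\Delta^{n-1}=\{p_i\ge0,\sum_ip_i=1\}$ is $\dot p_i=4p_i(\rho(p)-|\lambda_i-z(p)|^2)$ with $z(p)=\sum_jp_j\lambda_j$, $\rho(p)=\sum_jp_j|\lambda_j-z(p)|^2$; it is the flow of $p_i=|u_i|^2$ induced by the negative gradient flow of $\rho_A(u)=\|Au-(u^*Au)u\|^2$ on $\mathbb{CP}^{n-1}$. A critical torus $C(p^* )$ is the set of $[u]\in\mathbb{CP}^{n-1}$ with $|u_i|^2=p_i^*$ for all $i$, where these points are critical for $\rho_A$; with $S=\{i:p^*_i>0\}$, $c=z(p^* )$, $R^2=\rho(p^* )$ and $q_i=\lambda_i-c$, this means $|q_i|=R$ for all $i\in S$, and one has $\sum_{i\in S}p_i^*q_i=0$. Also \[ V_S=\Bigl\{a=(a_i)_{i\in S}\in\mathbb R^S:\sum_{i\in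 S}a_i=0\Bigr\},\qquad \delta z=\sum_{i\in S}a_i\lambda_i=\sum_{i\in S}a_iq_i . \] *)

theory Defs
  imports "HOL-Analysis.Analysis"
begin

section \<open>The residual on complex projective space\<close>

definition diag :: "complex^'n \<Rightarrow> complex^'n^'n" where
  "diag lam = (\<chi> i j. if i = j then lam $ i else 0)"

definition rayleigh :: "complex^'n^'n \<Rightarrow> complex^'n \<Rightarrow> complex" where
  "rayleigh A u = (\<Sum>i\<in>UNIV. cnj (u $ i) * (A *v u) $ i)"

text \<open>The formula for the residual on unit vectors.\<close>

definition residual :: "complex^'n^'n \<Rightarrow> complex^'n \<Rightarrow> real" where
  "residual A u = (norm (A *v u - rayleigh A u *s u))\<^sup>2"

text \<open>A point of projective space is represented by the set of all nonzero multiples of a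
  nonzero vector.\<close>

definition proj_point :: "complex^'n \<Rightarrow> (complex^'n) set" where
  "proj_point u = {k *s u | k. k \<noteq> 0}"

definition proj_space :: "(complex^'n) set set" where
  "proj_space = proj_point ` {u. u \<noteq> 0}"

text \<open>The choice of the unit representative is immaterial, see
  \<open>residual_proj_proj_point\<close> below.\<close>

definition residual_proj :: "complex^'n^'n \<Rightarrow> (complex^'n) set \<Rightarrow> real" where
  "residual_proj A P = residual A (SOME u. u \<in> P \<and> norm u = 1)"

text \<open>The map \<^term>\<open>proj_point\<close> from the nonzero vectors onto projective space is a surjective
  submersion, so the differential of a function at a point \<open>P\<close> vanishes iff the derivative of
  its pullback vanishes at the vectors representing \<open>P\<close>.\<close>

definition critical_point :: "((complex^'n) set \<Rightarrow> real) \<Rightarrow> (complex^'n) set \<Rightarrow> bool" where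
  "critical_point f P \<longleftrightarrow> P \<in> proj_space \<and>
     (\<forall>u. u \<noteq> 0 \<and> proj_point u = P \<longrightarrow>
        ((\<lambda>v. f (proj_point v)) has_derivative (\<lambda>_. 0)) (at u))"

lemma residual_phase:
  fixes u :: "complex^'n"
  assumes "cmod k = 1"
  shows "residual A (k *s u) = residual A u"
proof -
  have k: "cnj k * k = 1"
    using assms by (metis complex_norm_square mult.commute of_real_1 power_one)
  have mv: "A *v (k *s u) = k *s (A *v u)"
    by (simp add: vec_eq_iff matrix_vector_mult_def sum_distrib_left algebra_simps)
  have "rayleigh A (k *s u) = (\<Sum>i\<in>UNIV. (cnj k * k) * (cnj (u $ i) * (A *v u) $ i))"
    unfolding rayleigh_def mv by (simp add: algebra_simps)
  hence r: "rayleigh A (k *s u) = rayleigh A u"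
    unfolding k rayleigh_def by simp
  have "A *v (k *s u) - rayleigh A (k *s u) *s (k *s u) = k *s (A *v u - rayleigh A u *s u)"
    unfolding r mv by (simp add: vec_eq_iff algebra_simps)
  moreover have "norm (k *s w) = norm w" for w :: "complex^'n"
    by (simp add: norm_vec_def norm_mult assms)
  ultimately show ?thesis
    unfolding residual_def by metis
qed

lemma residual_proj_proj_point:
  fixes u :: "complex^'n"
  assumes "norm u = 1"
  shows "residual_proj A (proj_point u) = residual A u"
proof -
  define w where "w = (SOME w. w \<in> proj_point u \<and> norm w = 1)"
  have "u \<in> proj_point u"
    unfolding proj_point_def by (auto intro!: exI[of _ 1])
  hence "w \<in> proj_point u \<and> norm w = 1"
    unfolding w_def using assms by (intro someI) auto
  then obtain k where w: "w = k *s u" "norm (k *s u) = 1"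
    unfolding proj_point_def by auto
  have "norm (k *s u) = cmod k * norm u"
    by (simp add: norm_vec_def norm_mult L2_set_right_distrib)
  hence "cmod k = 1"
    using w assms by simp
  thus ?thesis
    unfolding residual_proj_def w_def[symmetric] w(1) by (rule residual_phase)
qed


section \<open>Critical tori and the residual flow on the simplex\<close>

definition prob_simplex :: "(real^'n) set" where
  "prob_simplex = {p. (\<forall>i. 0 \<le> p $ i) \<and> (\<Sum>i\<in>UNIV. p $ i) = 1}"

definition torus :: "real^'n \<Rightarrow> (complex^'n) set set" where
  "torus p = {proj_point u | u. norm u = 1 \<and> (\<forall>i. (cmod (u $ i))\<^sup>2 = p $ i)}"

definition critical_torus :: "complex^'n \<Rightarrow> (complex^'n) set set \<Rightarrow> real^'n \<Rightarrow> bool" where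
  "critical_torus lam C p \<longleftrightarrow> p \<in> prob_simplex \<and> C = torus p \<and>
     (\<forall>P\<in>C. critical_point (residual_proj (diag lam)) P)"

definition active :: "real^'n \<Rightarrow> 'n set" where
  "active p = {i. 0 < p $ i}"

definition bary :: "complex^'n \<Rightarrow> real^'n \<Rightarrow> complex" where
  "bary lam p = (\<Sum>j\<in>UNIV. complex_of_real (p $ j) * lam $ j)"

definition spread :: "complex^'n \<Rightarrow> real^'n \<Rightarrow> real" where
  "spread lam p = (\<Sum>j\<in>UNIV. p $ j * (cmod (lam $ j - bary lam p))\<^sup>2)"

definition residual_field :: "complex^'n \<Rightarrow> real^'n \<Rightarrow> real^'n" where
  "residual_field lam p =
     (\<chi> i. 4 * p $ i * (spread lam p - (cmod (lam $ i - bary lam p))\<^sup>2))"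

text \<open>Vectors indexed by \<open>S\<close> are identified with vectors vanishing outside \<open>S\<close>: this is the
  requirement that the inactive coordinates are kept zero.\<close>

definition active_space :: "'n set \<Rightarrow> (real^'n) set" where
  "active_space S = {a. (\<forall>i. i \<notin> S \<longrightarrow> a $ i = 0) \<and> (\<Sum>i\<in>S. a $ i) = 0}"

definition delta_z :: "complex^'n \<Rightarrow> 'n set \<Rightarrow> real^'n \<Rightarrow> complex" where
  "delta_z lam S a = (\<Sum>i\<in>S. complex_of_real (a $ i) * lam $ i)"

text \<open>The linearization at \<open>p\<close> of the residual flow under perturbations \<open>p + a\<close> with \<open>a\<close> in
  \<^term>\<open>active_space (active p)\<close>. A derivative at \<open>0\<close> within this subspace is uniquely determined
  only on the subspace, so only the values there are meaningful.\<close>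

definition active_linearization :: "complex^'n \<Rightarrow> real^'n \<Rightarrow> real^'n \<Rightarrow> real^'n" where
  "active_linearization lam p =
     frechet_derivative (\<lambda>a. residual_field lam (p + a)) (at 0 within active_space (active p))"

end

theory Submission
  imports Defs
begin

text \<open>
  Write \<open>z\<close> for the barycentre, \<open>\<rho>\<close> for the spread and \<open>q\<^sub>i = \<lambda>\<^sub>i - z\<close>. The product rule applied to
  \<open>4 p\<^sub>i (\<rho> - |q\<^sub>i|\<^sup>2)\<close> gives, in the direction \<open>a\<close>,
  \<open>4 a\<^sub>i (\<rho> - |q\<^sub>i|\<^sup>2) + 4 p\<^sub>i (\<Sum>\<^sub>j a\<^sub>j |q\<^sub>j|\<^sup>2 + 2 q\<^sub>i \<bullet> \<delta>z)\<close>: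
  the movement of the barycentre inside \<open>\<rho>\<close> has no first-order effect because the weighted
  deviations \<open>p\<^sub>j q\<^sub>j\<close> add up to zero (lemma \<open>residual_field_has_derivative\<close>).
  On a critical torus all active \<open>|q\<^sub>i|\<^sup>2\<close> equal \<open>\<rho>\<close>. Hence the first term vanishes, and the sum over
  \<open>j\<close> is \<open>\<rho> \<Sum>\<^sub>j a\<^sub>j = 0\<close>; only \<open>8 p\<^sub>i (q\<^sub>i \<bullet> \<delta>z)\<close> is left.

  The equidistance of the active eigenvalues is extracted from criticality on projective space
  (lemma \<open>critical_torus_equidistant\<close>). For diagonal matrices the residual is the spread of the
  squared moduli of the coordinates, so along every curve in the simplex that starts at \<open>p\<close> and
  lifts differentiably to unit vectors the spread is stationary at \<open>p\<close>. Moving \<open>p\<close> along the residual flow itself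
  makes that derivative \<open>- \<Sum>\<^sub>j p\<^sub>j (\<rho> - |q\<^sub>j|\<^sup>2)\<^sup>2\<close>, up to a positive factor, and each summand must
  then be zero.

  Finally, a derivative within the subspace of active directions is not unique as a linear map,
  but its values on the subspace are, since each of them is a derivative along a line
  (lemma \<open>has_derivative_within_directional_unique\<close>).
\<close>

section \<open>Derivatives\<close>

lemma has_derivative_vecI:
  fixes f :: "'a::real_normed_vector \<Rightarrow> ('b::euclidean_space)^'n"
  assumes "\<And>i. ((\<lambda>x. f x $ i) has_derivative (\<lambda>h. F h $ i)) (at x within T)"
  shows "(f has_derivative F) (at x within T)"
proof (subst has_derivative_componentwise_within, intro ballI)
  fix b :: "'b^'n" assume "b \<in> Basis"
  then obtain i c where "b = axis i c" by (auto simp: Basis_vec_def)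
  thus "((\<lambda>x. f x \<bullet> b) has_derivative (\<lambda>h. F h \<bullet> b)) (at x within T)"
    using has_derivative_inner_left[OF assms[of i], of c] by (simp add: inner_axis)
qed

text \<open>Restricting a function to a line inside \<open>T\<close> turns any derivative within \<open>T\<close> into an ordinary
  one-variable derivative, and these are unique. The set \<open>T\<close> may be too thin to determine the
  derivative in other directions.\<close>

lemma has_derivative_within_directional_unique:
  fixes f :: "'a::real_normed_vector \<Rightarrow> 'b::real_normed_vector"
  assumes f: "(f has_derivative F) (at x within T)" and g: "(f has_derivative G) (at x within T)"
    and line: "\<And>t. x + t *\<^sub>R a \<in> T"
  shows "F a = G a"
proof -
  have *: "((\<lambda>t. f (x + t *\<^sub>R a)) has_vector_derivative H a) (at 0)"
    if H: "(f has_derivative H) (at x within T)" for H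
  proof -
    have "((\<lambda>t. x + t *\<^sub>R a) has_derivative (\<lambda>t. t *\<^sub>R a)) (at 0)"
      by (auto intro!: derivative_eq_intros)
    moreover have "(f has_derivative H) (at (x + 0 *\<^sub>R a) within range (\<lambda>t. x + t *\<^sub>R a))"
      using has_derivative_subset[OF H] line by (simp add: image_subset_iff)
    ultimately have "((\<lambda>t. f (x + t *\<^sub>R a)) has_derivative (\<lambda>t. H (t *\<^sub>R a))) (at 0)"
      by (rule has_derivative_in_compose)
    thus ?thesis
      using linear_cmul[OF has_derivative_linear[OF H]] by (simp add: has_vector_derivative_def)
  qed
  show ?thesis by (rule vector_derivative_unique_at[OF *[OF f] *[OF g]])
qed

section \<open>Barycentre and spread\<close>

lemma prob_simplex_mass:
  assumes "p \<in> prob_simplex"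
  shows "(\<Sum>i\<in>UNIV. p $ i) = 1"
  using assms by (simp add: prob_simplex_def)

lemma bounded_linear_bary: "bounded_linear (bary lam)"
proof -
  have "bounded_linear (\<lambda>a. \<Sum>j\<in>UNIV. complex_of_real (a $ j) * lam $ j)"
    by (intro bounded_linear_sum bounded_linear_mult_const
        bounded_linear_compose[OF bounded_linear_of_real] bounded_linear_vec_nth)
  thus ?thesis by (simp add: bary_def[abs_def])
qed

lemma weighted_deviations_sum_zero:
  fixes lam :: "complex^'n"
  assumes "(\<Sum>i\<in>UNIV. p $ i) = 1"
  shows "(\<Sum>i\<in>UNIV. complex_of_real (p $ i) * (lam $ i - bary lam p)) = 0"
proof -
  have "(\<Sum>i\<in>UNIV. complex_of_real (p $ i) * bary lam p)
      = complex_of_real (\<Sum>i\<in>UNIV. p $ i) * bary lam p"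
    by (simp add: sum_distrib_right)
  thus ?thesis using assms by (simp add: algebra_simps sum_subtractf bary_def)
qed

lemma weighted_deviations_inner_sum_zero:
  fixes lam :: "complex^'n"
  assumes "(\<Sum>i\<in>UNIV. p $ i) = 1"
  shows "(\<Sum>i\<in>UNIV. p $ i * ((lam $ i - bary lam p) \<bullet> d)) = 0"
proof -
  have "(\<Sum>i\<in>UNIV. p $ i * ((lam $ i - bary lam p) \<bullet> d))
      = (\<Sum>i\<in>UNIV. complex_of_real (p $ i) * (lam $ i - bary lam p)) \<bullet> d"
    by (simp add: inner_sum_left scaleR_conv_of_real[symmetric])
  thus ?thesis using weighted_deviations_sum_zero[OF assms] by simp
qed

text \<open>The parallel axis theorem: the second moment about \<open>w\<close> exceeds the one about the barycentre by
  the squared distance of the two points. With \<open>w\<close> held fixed, the dependence of the spread on the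
  weights becomes explicit.\<close>

lemma spread_about_point:
  fixes lam :: "complex^'n"
  assumes "(\<Sum>i\<in>UNIV. p $ i) = 1"
  shows "spread lam p
    = (\<Sum>i\<in>UNIV. p $ i * (cmod (lam $ i - w))\<^sup>2) - (cmod (bary lam p - w))\<^sup>2"
proof -
  let ?z = "bary lam p"
  have "(cmod (lam $ i - w))\<^sup>2 = (cmod (lam $ i - ?z))\<^sup>2
      + 2 * ((lam $ i - ?z) \<bullet> (?z - w)) + (cmod (?z - w))\<^sup>2" for i
    by (simp add: power2_norm_eq_inner inner_diff_left inner_diff_right inner_commute)
  hence "p $ i * (cmod (lam $ i - w))\<^sup>2 = p $ i * (cmod (lam $ i - ?z))\<^sup>2
      + 2 * (p $ i * ((lam $ i - ?z) \<bullet> (?z - w))) + p $ i * (cmod (?z - w))\<^sup>2" for i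
    by (simp only: distrib_left mult.left_commute)
  hence "(\<Sum>i\<in>UNIV. p $ i * (cmod (lam $ i - w))\<^sup>2) = spread lam p
      + 2 * (\<Sum>i\<in>UNIV. p $ i * ((lam $ i - ?z) \<bullet> (?z - w)))
      + (\<Sum>i\<in>UNIV. p $ i) * (cmod (?z - w))\<^sup>2"
    by (simp only: spread_def sum.distrib sum_distrib_left sum_distrib_right)
  thus ?thesis
    using assms weighted_deviations_inner_sum_zero[OF assms]
    by (simp add: norm_minus_commute)
qed

text \<open>Taking moments about the old barycentre, the new one enters only through its squared
  displacement, which is of second order in \<open>t\<close>.\<close>

lemma spread_along_line:
  fixes lam :: "complex^'n"
  assumes p: "(\<Sum>i\<in>UNIV. p $ i) = 1" and a: "(\<Sum>i\<in>UNIV. a $ i) = 0"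
  shows "spread lam (p + t *\<^sub>R a) = spread lam p
    + t * (\<Sum>i\<in>UNIV. a $ i * (cmod (lam $ i - bary lam p))\<^sup>2) - t\<^sup>2 * (cmod (bary lam a))\<^sup>2"
proof -
  interpret bounded_linear "bary lam" by (rule bounded_linear_bary)
  have s: "(\<Sum>i\<in>UNIV. (p + t *\<^sub>R a) $ i) = 1"
    using p a by (simp add: sum.distrib sum_distrib_left[symmetric])
  have "bary lam (p + t *\<^sub>R a) - bary lam p = t *\<^sub>R bary lam a"
    by (simp add: add scaleR)
  thus ?thesis
    unfolding spread_about_point[OF s, of lam "bary lam p"]
    by (simp add: power_mult_distrib algebra_simps sum.distrib sum_distrib_left spread_def)
qed

section \<open>The residual of a diagonal matrix\<close>

lemma diag_mult_vec: "(diag lam *v u) $ i = lam $ i * u $ i"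
proof -
  have "(diag lam *v u) $ i = (\<Sum>j\<in>UNIV. if i = j then lam $ i * u $ j else 0)"
    unfolding diag_def matrix_vector_mult_def vec_lambda_beta by (intro sum.cong) auto
  thus ?thesis by simp
qed

lemma rayleigh_diag:
  "rayleigh (diag lam) u = bary lam (\<chi> i. (cmod (u $ i))\<^sup>2)"
  unfolding rayleigh_def bary_def diag_mult_vec
  by (intro sum.cong) (simp_all add: complex_norm_square mult_ac del: of_real_power)

lemma residual_diag:
  fixes lam :: "complex^'n"
  shows "residual (diag lam) u = spread lam (\<chi> i. (cmod (u $ i))\<^sup>2)"
proof -
  have "(norm (diag lam *v u - rayleigh (diag lam) u *s u))\<^sup>2
     = (\<Sum>i\<in>UNIV. (cmod ((lam $ i - rayleigh (diag lam) u) * u $ i))\<^sup>2)"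
    by (simp add: norm_vec_def L2_set_def sum_nonneg diag_mult_vec algebra_simps)
  thus ?thesis
    by (simp add: residual_def spread_def rayleigh_diag norm_mult power_mult_distrib mult_ac)
qed

lemma norm_sqrt_vec:
  fixes p :: "real^'n"
  assumes "p \<in> prob_simplex"
  shows "norm (\<chi> i. complex_of_real (sqrt (p $ i))) = 1"
  using assms by (simp add: prob_simplex_def norm_vec_def L2_set_def)

lemma residual_proj_sqrt_vec:
  fixes p :: "real^'n"
  assumes "p \<in> prob_simplex"
  shows "residual_proj (diag lam) (proj_point (\<chi> i. complex_of_real (sqrt (p $ i))))
    = spread lam p"
proof -
  have "(\<chi> i. (cmod ((\<chi> i. complex_of_real (sqrt (p $ i))) $ i))\<^sup>2) = p"
    using assms by (simp add: prob_simplex_def vec_eq_iff)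
  thus ?thesis
    by (simp only: residual_proj_proj_point[OF norm_sqrt_vec[OF assms]] residual_diag)
qed

section \<open>Active eigenvalues on a critical torus are equidistant from the barycentre\<close>

text \<open>The perturbation \<open>a\<^sub>j = p\<^sub>j b\<^sub>j\<close>, with \<open>b\<^sub>j\<close> the defect of equidistance at \<open>j\<close>, is a multiple of the
  residual field. It keeps the total mass, and it is proportional to \<open>p\<close>, so that the square-root
  lift \<open>\<surd>p\<^sub>j \<surd>(1 + t b\<^sub>j)\<close> to unit vectors stays differentiable at \<open>t = 0\<close> even where \<open>p\<^sub>j = 0\<close>.
  Criticality makes the spread stationary along this curve.\<close>

lemma critical_torus_equidistant:
  fixes lam :: "complex^'n" and p :: "real^'n"
  assumes crit: "critical_torus lam C p" and i: "i \<in> active p"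
  shows "(cmod (lam $ i - bary lam p))\<^sup>2 = spread lam p"
proof -
  have p: "p \<in> prob_simplex" using crit by (simp add: critical_torus_def)
  have p0: "0 \<le> p $ j" for j using p by (simp add: prob_simplex_def)
  note p1 = prob_simplex_mass[OF p]
  define b where "b j = spread lam p - (cmod (lam $ j - bary lam p))\<^sup>2" for j
  define a where "a = (\<chi> j. p $ j * b j)"
  define v where "v t = (\<chi> j. complex_of_real (sqrt ((p + t *\<^sub>R a) $ j)))" for t
  have fac: "(p + t *\<^sub>R a) $ j = p $ j * (1 + t * b j)" for t j
    by (simp add: a_def algebra_simps)
  have sum_a: "(\<Sum>j\<in>UNIV. a $ j) = 0"
    using p1 by (simp add: a_def b_def algebra_simps sum_subtractf sum_distrib_left[symmetric])
       (simp add: spread_def mult.commute)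
  have v0: "norm (v 0) = 1" using norm_sqrt_vec[OF p] by (simp add: v_def)
  define v' where "v' = (\<chi> j. complex_of_real (sqrt (p $ j) * (b j / 2)))"
  have v': "(v has_derivative (\<lambda>t. t *\<^sub>R v')) (at 0)"
  proof (rule has_derivative_vecI)
    fix j
    have "((\<lambda>t. sqrt (p $ j) * sqrt (1 + t * b j)) has_real_derivative
        sqrt (p $ j) * (b j / 2)) (at 0)"
      by (auto intro!: derivative_eq_intros simp: field_simps)
    from has_vector_derivative_of_real[OF this]
    have "((\<lambda>t. complex_of_real (sqrt (p $ j) * sqrt (1 + t * b j))) has_derivative
        (\<lambda>t. t *\<^sub>R complex_of_real (sqrt (p $ j) * (b j / 2)))) (at 0)"
      by (simp only: has_vector_derivative_def)
    thus "((\<lambda>t. v t $ j) has_derivative (\<lambda>t. (t *\<^sub>R v') $ j)) (at 0)"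
      by (simp only: v_def v'_def fac real_sqrt_mult vec_lambda_beta vector_scaleR_component)
  qed
  have "v 0 \<noteq> 0" using v0 by auto
  have "proj_point (v 0) \<in> torus p"
    unfolding torus_def using v0 p0 by (auto simp: v_def)
  hence "critical_point (residual_proj (diag lam)) (proj_point (v 0))"
    using crit by (simp add: critical_torus_def)
  hence "((\<lambda>w. residual_proj (diag lam) (proj_point w)) has_derivative (\<lambda>_. 0)) (at (v 0))"
    using \<open>v 0 \<noteq> 0\<close> unfolding critical_point_def by blast
  from has_derivative_compose[OF v' this]
  have D0: "((\<lambda>t. residual_proj (diag lam) (proj_point (v t))) has_real_derivative 0) (at 0)"
    by (rule has_derivative_imp_has_field_derivative) simp
  have simplex: "\<forall>\<^sub>F t in nhds 0. p + t *\<^sub>R a \<in> prob_simplex"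
  proof -
    have "((\<lambda>t. 1 + t * b j) \<longlongrightarrow> 1 + 0 * b j) (nhds 0)" for j
      by (intro tendsto_intros filterlim_ident)
    hence "\<forall>\<^sub>F t in nhds 0. 0 < 1 + t * b j" for j
      by (intro order_tendstoD) auto
    hence "\<forall>\<^sub>F t in nhds 0. \<forall>j. 0 < 1 + t * b j"
      by (simp add: eventually_all_finite)
    thus ?thesis
    proof (rule eventually_mono)
      fix t assume *: "\<forall>j. 0 < 1 + t * b j"
      have "0 \<le> (p + t *\<^sub>R a) $ j" for j
        unfolding fac using * p0 by (simp add: less_imp_le)
      moreover have "(\<Sum>j\<in>UNIV. (p + t *\<^sub>R a) $ j) = 1"
        using p1 sum_a by (simp add: sum.distrib sum_distrib_left[symmetric])
      ultimately show "p + t *\<^sub>R a \<in> prob_simplex" by (simp add: prob_simplex_def)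
    qed
  qed
  let ?d = "\<Sum>j\<in>UNIV. a $ j * (cmod (lam $ j - bary lam p))\<^sup>2"
  \<comment> \<open>The squared moduli of the lifted point are the perturbed weights only while these are
    nonnegative, which is why the identity is local.\<close>
  have "\<forall>\<^sub>F t in nhds 0. residual_proj (diag lam) (proj_point (v t))
      = spread lam p + t * ?d - t\<^sup>2 * (cmod (bary lam a))\<^sup>2"
    using simplex
    by (rule eventually_mono)
      (simp only: v_def residual_proj_sqrt_vec spread_along_line[OF p1 sum_a])
  from iffD1[OF DERIV_cong_ev[OF refl this refl] D0]
  have "((\<lambda>t. spread lam p + t * ?d - t\<^sup>2 * (cmod (bary lam a))\<^sup>2)
      has_real_derivative 0) (at 0)" .
  moreover have "((\<lambda>t. spread lam p + t * ?d - t\<^sup>2 * (cmod (bary lam a))\<^sup>2)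
      has_real_derivative ?d) (at 0)"
    by (auto intro!: derivative_eq_intros)
  ultimately have d: "?d = 0" by (rule DERIV_unique[symmetric])
  \<comment> \<open>The variance of the squared distances is minus the derivative just computed.\<close>
  have "(\<Sum>j\<in>UNIV. p $ j * (b j)\<^sup>2) = (\<Sum>j\<in>UNIV. a $ j * b j)"
    by (simp add: a_def power2_eq_square mult_ac)
  also have "\<dots> = (\<Sum>j\<in>UNIV. a $ j) * spread lam p - ?d"
    by (simp add: b_def algebra_simps sum_subtractf sum_distrib_left)
  finally have "(\<Sum>j\<in>UNIV. p $ j * (b j)\<^sup>2) = 0" using d sum_a by simp
  hence "p $ i * (b i)\<^sup>2 = 0"
    using p0 by (subst (asm) sum_nonneg_eq_0_iff) auto
  thus ?thesis using i by (simp add: active_def b_def)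
qed

section \<open>Linearization of the residual flow\<close>

text \<open>This is valid at every point of total mass one and for all directions \<open>a\<close>, also those that
  leave the simplex. The mass is what makes the weighted deviations cancel, which removes
  the contribution of the moving barycentre to the derivative of the spread.\<close>

lemma residual_field_has_derivative:
  fixes lam :: "complex^'n"
  defines "q \<equiv> \<lambda>p i. lam $ i - bary lam p"
  assumes p: "(\<Sum>i\<in>UNIV. p $ i) = 1"
  shows "((\<lambda>a. residual_field lam (p + a)) has_derivative
    (\<lambda>a. \<chi> i. 4 * a $ i * (spread lam p - (cmod (q p i))\<^sup>2)
      + 4 * p $ i * ((\<Sum>j\<in>UNIV. a $ j * (cmod (q p j))\<^sup>2) + 2 * (q p i \<bullet> bary lam a))))
    (at 0)"
proof -
  interpret bounded_linear "bary lam" by (rule bounded_linear_bary)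
  have q_eq: "lam $ i - bary lam r = q r i" for r i
    by (simp add: q_def)
  have nth: "((\<lambda>a. (p + a) $ i) has_derivative (\<lambda>a. a $ i)) (at 0)" for i
    by (auto intro!: derivative_eq_intros bounded_linear.has_derivative[OF bounded_linear_vec_nth])
  have dist: "((\<lambda>a. (cmod (q (p + a) i))\<^sup>2) has_derivative
      (\<lambda>a. - 2 * (q p i \<bullet> bary lam a))) (at 0)" for i
    unfolding q_def power2_norm_eq_inner
    by (auto intro!: derivative_eq_intros has_derivative simp: inner_commute add)
  have "((\<lambda>a. spread lam (p + a)) has_derivative
      (\<lambda>a. \<Sum>j\<in>UNIV. a $ j * (cmod (q p j))\<^sup>2 - p $ j * (2 * (q p j \<bullet> bary lam a)))) (at 0)"
    unfolding spread_def q_eq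
  proof (rule has_derivative_sum)
    fix j
    show "((\<lambda>a. (p + a) $ j * (cmod (q (p + a) j))\<^sup>2) has_derivative
      (\<lambda>a. a $ j * (cmod (q p j))\<^sup>2 - p $ j * (2 * (q p j \<bullet> bary lam a)))) (at 0)"
      using has_derivative_mult[OF nth dist, of j j] by (simp add: algebra_simps)
  qed
  moreover have "(\<Sum>j\<in>UNIV. p $ j * (2 * (q p j \<bullet> d))) = 0" for d
    using weighted_deviations_inner_sum_zero[OF p, of lam d]
    by (simp add: q_def mult.left_commute[of _ 2] sum_distrib_left[symmetric])
  ultimately have spread: "((\<lambda>a. spread lam (p + a)) has_derivative
      (\<lambda>a. \<Sum>j\<in>UNIV. a $ j * (cmod (q p j))\<^sup>2)) (at 0)"
    by (simp add: sum_subtractf)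
  show ?thesis
  proof (rule has_derivative_vecI)
    fix i
    show "((\<lambda>a. residual_field lam (p + a) $ i) has_derivative (\<lambda>a. (\<chi> i.
        4 * a $ i * (spread lam p - (cmod (q p i))\<^sup>2)
        + 4 * p $ i * ((\<Sum>j\<in>UNIV. a $ j * (cmod (q p j))\<^sup>2) + 2 * (q p i \<bullet> bary lam a))) $ i))
        (at 0)"
      unfolding residual_field_def vec_lambda_beta q_eq
      using has_derivative_mult[OF has_derivative_mult_right[OF nth[of i], of 4]
          has_derivative_diff[OF spread dist[of i]]]
      by (simp add: algebra_simps)
  qed
qed

theorem proposition5p2:
  fixes lam q :: "complex^'n" and p :: "real^'n"
    and C :: "(complex^'n) set set" and S :: "'n set"
  assumes "inj (\<lambda>i. lam $ i)"
    and "critical_torus lam C p"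
    and "S = active p"
    and "\<And>i. q $ i = lam $ i - bary lam p"
  shows "(\<lambda>a. residual_field lam (p + a)) differentiable (at 0 within active_space S) \<and>
    (\<forall>a\<in>active_space S. \<forall>i\<in>S.
       active_linearization lam p a $ i = 8 * p $ i * Re (q $ i * cnj (delta_z lam S a))) \<and>
    (\<forall>a\<in>active_space S. \<forall>i\<in>S.
       active_linearization lam p a $ i = 8 * p $ i * (q $ i \<bullet> delta_z lam S a))"
proof -
  let ?f = "\<lambda>a. residual_field lam (p + a)"
  have "p \<in> prob_simplex" using assms(2) by (simp add: critical_torus_def)
  note D = has_derivative_at_withinI[OF residual_field_has_derivative[OF prob_simplex_mass[OF this]],
      where s = "active_space S"]
  have diff: "?f differentiable (at 0 within active_space S)"
    using D by (rule differentiableI)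
  note L = diff[unfolded frechet_derivative_works]
  have equidistant: "(cmod (q $ i))\<^sup>2 = spread lam p" if "i \<in> S" for i
    using critical_torus_equidistant[OF assms(2)] that assms(3,4) by simp
  have inner: "active_linearization lam p a $ i = 8 * p $ i * (q $ i \<bullet> delta_z lam S a)"
    if a: "a \<in> active_space S" and i: "i \<in> S" for a i
  proof -
    have a0: "a $ j = 0" if "j \<notin> S" for j using a that by (simp add: active_space_def)
    have dz: "bary lam a = delta_z lam S a"
      unfolding bary_def delta_z_def using a0 by (intro sum.mono_neutral_right) auto
    have "(\<Sum>j\<in>UNIV. a $ j * (cmod (q $ j))\<^sup>2) = (\<Sum>j\<in>S. a $ j * (cmod (q $ j))\<^sup>2)"
      using a0 by (intro sum.mono_neutral_right) auto
    also have "\<dots> = (\<Sum>j\<in>S. a $ j) * spread lam p"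
      by (simp add: equidistant sum_distrib_right)
    also have "\<dots> = 0" using a by (simp add: active_space_def)
    finally have ds: "(\<Sum>j\<in>UNIV. a $ j * (cmod (lam $ j - bary lam p))\<^sup>2) = 0"
      by (simp add: assms(4))
    have "0 + t *\<^sub>R a \<in> active_space S" for t
      using a by (simp add: active_space_def sum_distrib_left[symmetric])
    from has_derivative_within_directional_unique[OF L D this]
    show ?thesis
      unfolding active_linearization_def assms(3)[symmetric]
      using equidistant[OF i] by (simp add: ds dz assms(4))
  qed
  moreover have "Re (q $ i * cnj w) = q $ i \<bullet> w" for i w
    by (simp add: inner_complex_def)
  ultimately show ?thesis using diff by simp
qed

end
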